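(* Let $p,q\ge0$, $p+q\ge1$, let $S_1,\dots,S_{p+q}$ be the basis matrices of a non-degenerate representation of $R_{p,q}=C_p\otimes C_q$ on $W=\mathbb{R}^m$, and let $\tilde P(w)=S_1[w]^2+\cdots+S_p[w]^2-S_{p+1}[w]^2-\cdots-S_{p+q}[w]^2$ be the associated Clifford quartic form. Then $\tilde P$ is a homaloidal EKP-polynomial, and the multiplicative Legendre transform of $\tilde P$ coincides with $\tilde P$ itself up to a constant factor.
   Context: $C_r$ denotes the real Clifford algebra of the positive definite quadratic form in $r$ variables (generators $e_i$, $e_i^2=1$, $e_ie_j=-e_je_i$ for $i\ne j$; $C_0=\mathbb{R}$). $R_{p,q}=C_p\otimes_{\mathbb{R}}C_q$ (ungraded tensor product), with $e_1,\dots,e_p$ the generators of $C_p$ and $e_{p+1},\dots,e_{p+q}$ those of $C_q$. A (unital) representation $\rho$ on $\mathbb{R}^m$ is taken so that the basis matrices $S_i=\rho(e_i)$ are symmetric; $S[w]={}^tw\,S\,w$. The representation is non-degenerate if $Q(w)=(S_1[w],\dots,S_{p+q}[w])$, as a polynomial map $\mathbb{C}^m\to\mathbb{C}^{p+q}$, has differential of rank $p+q$ at all points with $\tilde P\neq0$ and the set of such points is non-empty. Polynomials on $W$ are regarded as polynomials on $\mathbf{W}=\mathbb{C}^m$, and $\mathbf{W}^*$ is identified with $\mathbb{C}^m$ via the standard bilinear form. A homogeneous rational function $f$ on a finite-dimensional vector space $\mathbf{V}$ is homaloidal if $v\mapsto\mathrm{grad}\,f(v)$ defines a birational map $\mathbb{P}(\mathbf{V})\to\mathbb{P}(\mathbf{V}^*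 )$. For a homaloidal $f$ there is a rational function $f^*$ on $\mathbf{V}^*$ with $f^*(\mathrm{grad}\log f(v))=1/f(v)$, called the multiplicative Legendre transform of $f$. A polynomial $f$ is a homaloidal EKP-polynomial if $f$ is homaloidal and $f^*$ is also a polynomial. *)

theory Defs
  imports "HOL-Analysis.Analysis"
begin

section \<open>Clifford algebras and their tensor products\<close>

text \<open>
  The real Clifford algebra of the form \<open>\<Sum>i\<in>I. x\<^sub>i\<^sup>2\<close> has the basis
  \<open>e\<^sub>A = e\<^sub>a\<^sub>1 \<dots> e\<^sub>a\<^sub>k\<close>, where \<open>A = {a\<^sub>1 < \<dots> < a\<^sub>k} \<subseteq> I\<close>; its elements are given by
  their coefficients in this basis. Sorting \<open>e\<^sub>A e\<^sub>B\<close> takes one sign change for each pair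
  \<open>b < a\<close> with \<open>a \<in> A\<close>, \<open>b \<in> B\<close>, and the repeated generators cancel because \<open>e\<^sub>i\<^sup>2 = 1\<close>;
  hence \<open>e\<^sub>A e\<^sub>B = \<plusminus>e\<^sub>C\<close> with \<open>C\<close> the symmetric difference of \<open>A\<close> and \<open>B\<close>.
\<close>

definition clifford_sign :: "nat set \<Rightarrow> nat set \<Rightarrow> real" where
  "clifford_sign A B = (-1) ^ card {(a, b). a \<in> A \<and> b \<in> B \<and> b < a}"

definition clifford_carrier :: "nat set \<Rightarrow> (nat set \<Rightarrow> real) set" where
  "clifford_carrier I = {x. \<forall>A. x A \<noteq> 0 \<longrightarrow> A \<subseteq> I}"

definition clifford_basis :: "nat set \<Rightarrow> nat set \<Rightarrow> real" where
  "clifford_basis A = (\<lambda>B. if B = A then 1 else 0)"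

definition clifford_mult ::
    "nat set \<Rightarrow> (nat set \<Rightarrow> real) \<Rightarrow> (nat set \<Rightarrow> real) \<Rightarrow> nat set \<Rightarrow> real" where
  "clifford_mult I x y =
     (\<lambda>C. \<Sum>A\<in>Pow I. clifford_sign A (sym_diff A C) * x A * y (sym_diff A C))"

lemma clifford_sign_prod:
  assumes "finite A" "finite B"
  shows "clifford_sign A B = (\<Prod>a\<in>A. \<Prod>b\<in>B. if b < a then -1 else 1)"
proof -
  have eq: "{(a, b). a \<in> A \<and> b \<in> B \<and> b < a} = {z\<in>A \<times> B. snd z < fst z}"
    by auto
  have "(\<Prod>a\<in>A. \<Prod>b\<in>B. if b < a then -1 else 1) =
      (\<Prod>z\<in>A \<times> B. if snd z < fst z then -1 else (1::real))"
    by (simp add: prod.cartesian_product case_prod_beta)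
  also have "\<dots> = (\<Prod>z\<in>{z\<in>A \<times> B. snd z < fst z}. -1)"
    by (rule prod.inter_filter[symmetric]) (use assms in simp)
  finally show ?thesis
    unfolding clifford_sign_def eq by simp
qed

lemma prod_sym_diff:
  fixes f :: "'a \<Rightarrow> real"
  assumes "finite A" "finite B" "\<And>x. f x * f x = 1"
  shows "prod f (sym_diff A B) = prod f A * prod f B"
proof -
  have A: "prod f A = prod f (A - B) * prod f (A \<inter> B)"
    using assms(1) by (metis prod.Int_Diff mult.commute)
  have B: "prod f B = prod f (B - A) * prod f (A \<inter> B)"
    using assms(2) by (metis prod.Int_Diff mult.commute Int_commute)
  have "prod f (A \<inter> B) * prod f (A \<inter> B) = 1"
    by (simp flip: prod.distrib add: assms(3))
  moreover have "prod f (sym_diff A B) = prod f (A - B) * prod f (B - A)"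
    using assms by (intro prod.union_disjoint) auto
  ultimately show ?thesis
    unfolding A B by (simp add: algebra_simps)
qed

lemma clifford_sign_sym_diff_left:
  assumes "finite A" "finite B" "finite C"
  shows "clifford_sign (sym_diff A B) C = clifford_sign A C * clifford_sign B C"
proof -
  have *: "(\<Prod>b\<in>C. if b < x then -1 else 1) * (\<Prod>b\<in>C. if b < x then -1 else 1) = (1::real)" for x
    by (simp flip: prod.distrib add: if_distrib cong: if_cong)
  show ?thesis
    using assms prod_sym_diff[OF assms(1,2) *]
    by (simp add: clifford_sign_prod)
qed

lemma clifford_sign_sym_diff_right:
  assumes "finite A" "finite B" "finite C"
  shows "clifford_sign C (sym_diff A B) = clifford_sign C A * clifford_sign C B"
proof -
  have "(\<Prod>b\<in>sym_diff A B. if b < x then -1 else 1) =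
     (\<Prod>b\<in>A. if b < x then -1 else 1) * (\<Prod>b\<in>B. if b < x then -1 else (1::real))" for x
    by (rule prod_sym_diff) (use assms in auto)
  then show ?thesis
    using assms by (simp add: clifford_sign_prod prod.distrib)
qed

lemma clifford_sign_square: "clifford_sign A B * clifford_sign A B = 1"
  by (simp add: clifford_sign_def flip: power_mult_distrib)

lemma clifford_mult_basis:
  assumes "finite I" "A \<subseteq> I"
  shows "clifford_mult I (clifford_basis A) (clifford_basis B) =
    (\<lambda>C. clifford_sign A B * clifford_basis (sym_diff A B) C)"
proof
  fix C
  have eq: "sym_diff A C = B \<longleftrightarrow> C = sym_diff A B"
    by auto
  have "clifford_mult I (clifford_basis A) (clifford_basis B) C =
     (\<Sum>A'\<in>Pow I. if A' = A then clifford_sign A (sym_diff A C) * clifford_basis B (sym_diff A C) else 0)"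
    unfolding clifford_mult_def by (rule sum.cong) (auto simp: clifford_basis_def)
  also have "\<dots> = clifford_sign A (sym_diff A C) * clifford_basis B (sym_diff A C)"
    using assms by simp
  also have "\<dots> = clifford_sign A B * clifford_basis (sym_diff A B) C"
    using eq by (cases "C = sym_diff A B") (auto simp: clifford_basis_def)
  finally show "clifford_mult I (clifford_basis A) (clifford_basis B) C =
     clifford_sign A B * clifford_basis (sym_diff A B) C" .
qed

lemma clifford_mult_assoc:
  assumes "finite I" and z: "z \<in> clifford_carrier I"
  shows "clifford_mult I (clifford_mult I x y) z = clifford_mult I x (clifford_mult I y z)"
proof
  fix D
  show "clifford_mult I (clifford_mult I x y) z D = clifford_mult I x (clifford_mult I y z) D"
  proof (cases "D \<subseteq> I")
    case True
    have fin: "finite A" if "A \<subseteq> I" for A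
      using that assms(1) by (rule finite_subset)
    have D: "finite D" using True by (rule fin)
    have "clifford_mult I (clifford_mult I x y) z D =
        (\<Sum>A\<in>Pow I. \<Sum>B\<in>Pow I. clifford_sign A (sym_diff A D) * clifford_sign B (sym_diff B A) *
           x B * y (sym_diff B A) * z (sym_diff A D))"
      unfolding clifford_mult_def by (simp add: sum_distrib_left sum_distrib_right mult_ac)
    also have "\<dots> = (\<Sum>B\<in>Pow I. \<Sum>A\<in>Pow I. clifford_sign A (sym_diff A D) *
           clifford_sign B (sym_diff B A) * x B * y (sym_diff B A) * z (sym_diff A D))"
      by (rule sum.swap)
    also have "\<dots> = (\<Sum>B\<in>Pow I. \<Sum>A\<in>Pow I. clifford_sign B (sym_diff B D) *
           clifford_sign A (sym_diff A (sym_diff B D)) * x B * y A * z (sym_diff A (sym_diff B D)))"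
    proof (rule sum.cong[OF refl])
      fix B assume "B \<in> Pow I"
      then have B: "B \<subseteq> I" "finite B" using fin by auto
      show "(\<Sum>A\<in>Pow I. clifford_sign A (sym_diff A D) *
           clifford_sign B (sym_diff B A) * x B * y (sym_diff B A) * z (sym_diff A D)) =
         (\<Sum>A\<in>Pow I. clifford_sign B (sym_diff B D) *
           clifford_sign A (sym_diff A (sym_diff B D)) * x B * y A * z (sym_diff A (sym_diff B D)))"
      proof (rule sum.reindex_bij_witness[where i = "sym_diff B" and j = "sym_diff B"])
        fix A assume "A \<in> Pow I"
        then have A: "A \<subseteq> I" "finite A" using fin by auto
        have inv: "sym_diff B (sym_diff B A) = A" by auto
        have 1: "sym_diff (sym_diff B A) (sym_diff B D) = sym_diff A D" by auto
        have 2: "sym_diff B A = sym_diff (sym_diff B D) (sym_diff A D)" by auto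
        have "clifford_sign B (sym_diff B A) =
            clifford_sign B (sym_diff B D) * clifford_sign B (sym_diff A D)"
          unfolding 2 using A B D by (intro clifford_sign_sym_diff_right) auto
        moreover have "clifford_sign (sym_diff B A) (sym_diff A D) =
            clifford_sign B (sym_diff A D) * clifford_sign A (sym_diff A D)"
          using A B D by (intro clifford_sign_sym_diff_left) auto
        ultimately show "clifford_sign B (sym_diff B D) *
            clifford_sign (sym_diff B A) (sym_diff (sym_diff B A) (sym_diff B D)) * x B *
            y (sym_diff B A) * z (sym_diff (sym_diff B A) (sym_diff B D)) =
          clifford_sign A (sym_diff A D) * clifford_sign B (sym_diff B A) * x B *
            y (sym_diff B A) * z (sym_diff A D)"
          unfolding 1 by simp
      qed (use B in auto)
    qed
    also have "\<dots> = clifford_mult I x (clifford_mult I y z) D"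
      unfolding clifford_mult_def by (simp add: sum_distrib_left mult_ac)
    finally show ?thesis .
  next
    case False
    have "z (sym_diff A D) = 0" if "A \<subseteq> I" for A
      using that False z by (auto simp: clifford_carrier_def)
    moreover have "z (sym_diff A (sym_diff B D)) = 0" if "A \<subseteq> I" "B \<subseteq> I" for A B
      using that False z by (auto simp: clifford_carrier_def)
    ultimately show ?thesis
      by (simp add: clifford_mult_def)
  qed
qed

lemma clifford_mult_generators:
  assumes "finite I" "i \<in> I" "j \<in> I"
  shows "clifford_mult I (clifford_basis {i}) (clifford_basis {i}) = clifford_basis {}"
    and "i \<noteq> j \<Longrightarrow> clifford_mult I (clifford_basis {i}) (clifford_basis {j}) =
      (\<lambda>C. - clifford_mult I (clifford_basis {j}) (clifford_basis {i}) C)"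
proof -
  have s: "clifford_sign {a} {b} = (if b < a then -1 else 1)" for a b
    by (simp add: clifford_sign_prod)
  show "clifford_mult I (clifford_basis {i}) (clifford_basis {i}) = clifford_basis {}"
    using assms by (simp add: clifford_mult_basis s)
  show "clifford_mult I (clifford_basis {i}) (clifford_basis {j}) =
      (\<lambda>C. - clifford_mult I (clifford_basis {j}) (clifford_basis {i}) C)" if "i \<noteq> j"
    using assms that by (auto simp: clifford_mult_basis s Un_commute)
qed

text \<open>The generators generate: \<open>e\<^sub>A\<close> is the increasing product of the \<open>e\<^sub>a\<close>, \<open>a \<in> A\<close>.\<close>

lemma clifford_basis_insert:
  assumes "finite I" "i \<in> I" "A \<subseteq> I" "\<And>a. a \<in> A \<Longrightarrow> i < a"
  shows "clifford_basis (insert i A) = clifford_mult I (clifford_basis {i}) (clifford_basis A)"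
proof -
  have "finite A" using assms finite_subset by blast
  then have "clifford_sign {i} A = (\<Prod>b\<in>A. if b < i then -1 else 1)"
    by (simp add: clifford_sign_prod)
  also have "\<dots> = 1"
    using assms(4) by (intro prod.neutral) (auto dest: less_asym)
  finally have "clifford_sign {i} A = 1" .
  moreover have "i \<notin> A" using assms(4) by blast
  then have "sym_diff {i} A = insert i A" by auto
  ultimately show ?thesis
    using assms by (simp add: clifford_mult_basis)
qed

text \<open>
  \<open>R\<^sub>p\<^sub>,\<^sub>q = C\<^sub>p \<otimes> C\<^sub>q\<close> with the generators of \<open>C\<^sub>p\<close> indexed by \<open>{1..p}\<close> and those of
  \<open>C\<^sub>q\<close> by \<open>{p+1..p+q}\<close>. An element is given by its coefficients in the basis
  \<open>e\<^sub>A \<otimes> e\<^sub>B\<close>, and \<open>(e\<^sub>A \<otimes> e\<^sub>B) (e\<^sub>A\<^sub>' \<otimes> e\<^sub>B\<^sub>') = e\<^sub>A e\<^sub>A\<^sub>' \<otimes> e\<^sub>B e\<^sub>B\<^sub>'\<close>.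
\<close>

definition R_carrier :: "nat \<Rightarrow> nat \<Rightarrow> (nat set \<times> nat set \<Rightarrow> real) set" where
  "R_carrier p q = {x. \<forall>A B. x (A, B) \<noteq> 0 \<longrightarrow> A \<subseteq> {1..p} \<and> B \<subseteq> {p+1..p+q}}"

definition tensor :: "(nat set \<Rightarrow> real) \<Rightarrow> (nat set \<Rightarrow> real) \<Rightarrow> nat set \<times> nat set \<Rightarrow> real" where
  "tensor x y = (\<lambda>(A, B). x A * y B)"

definition R_mult ::
    "nat \<Rightarrow> nat \<Rightarrow> (nat set \<times> nat set \<Rightarrow> real) \<Rightarrow> (nat set \<times> nat set \<Rightarrow> real) \<Rightarrow>
       nat set \<times> nat set \<Rightarrow> real" where
  "R_mult p q x y =
     (\<lambda>(C, D). \<Sum>A\<in>Pow {1..p}. \<Sum>B\<in>Pow {p+1..p+q}.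
        clifford_sign A (sym_diff A C) * clifford_sign B (sym_diff B D) *
        x (A, B) * y (sym_diff A C, sym_diff B D))"

lemma R_mult_tensor:
  "R_mult p q (tensor x y) (tensor x' y') =
     tensor (clifford_mult {1..p} x x') (clifford_mult {p+1..p+q} y y')"
  by (rule ext)
     (auto simp: R_mult_def tensor_def clifford_mult_def sum_product mult_ac split: prod.splits)

definition R_one :: "nat set \<times> nat set \<Rightarrow> real" where
  "R_one = tensor (clifford_basis {}) (clifford_basis {})"

definition R_gen :: "nat \<Rightarrow> nat \<Rightarrow> nat set \<times> nat set \<Rightarrow> real" where
  "R_gen p i =
     (if i \<le> p then tensor (clifford_basis {i}) (clifford_basis {})
      else tensor (clifford_basis {}) (clifford_basis {i}))"

lemma R_gen_relations:
  assumes "i \<in> {1..p+q}" "j \<in> {1..p+q}"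
  shows "R_mult p q (R_gen p i) (R_gen p i) = R_one"
    and "i \<noteq> j \<Longrightarrow> i \<le> p \<longleftrightarrow> j \<le> p \<Longrightarrow>
      R_mult p q (R_gen p i) (R_gen p j) = (\<lambda>k. - R_mult p q (R_gen p j) (R_gen p i) k)"
    and "\<not> (i \<le> p \<longleftrightarrow> j \<le> p) \<Longrightarrow>
      R_mult p q (R_gen p i) (R_gen p j) = R_mult p q (R_gen p j) (R_gen p i)"
proof -
  have s: "clifford_sign A {} = 1" "clifford_sign {} A = 1" for A
    by (simp_all add: clifford_sign_def)
  have u: "clifford_mult I (clifford_basis {}) (clifford_basis A) = clifford_basis A"
    "A \<subseteq> I \<Longrightarrow> clifford_mult I (clifford_basis A) (clifford_basis {}) = clifford_basis A"
    if "finite I" for I A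
    using that by (simp_all add: clifford_mult_basis s)
  show "R_mult p q (R_gen p i) (R_gen p i) = R_one"
    using assms clifford_mult_generators(1)[of "{1..p}" i i] clifford_mult_generators(1)[of "{p+1..p+q}" i i]
    by (auto simp: R_gen_def R_one_def R_mult_tensor u)
  show "R_mult p q (R_gen p i) (R_gen p j) = (\<lambda>k. - R_mult p q (R_gen p j) (R_gen p i) k)"
    if "i \<noteq> j" "i \<le> p \<longleftrightarrow> j \<le> p"
  proof (cases "i \<le> p")
    case True
    have *: "clifford_mult {1..p} (clifford_basis {i}) (clifford_basis {j}) =
      (\<lambda>C. - clifford_mult {1..p} (clifford_basis {j}) (clifford_basis {i}) C)"
      by (rule clifford_mult_generators(2)) (use True that assms in auto)
    show ?thesis
      using True that by (simp only: R_gen_def R_mult_tensor if_True if_False * simp_thms) (auto simp: tensor_def fun_eq_iff)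
  next
    case False
    have *: "clifford_mult {p+1..p+q} (clifford_basis {i}) (clifford_basis {j}) =
      (\<lambda>C. - clifford_mult {p+1..p+q} (clifford_basis {j}) (clifford_basis {i}) C)"
      by (rule clifford_mult_generators(2)) (use False that assms in auto)
    show ?thesis
      using False that by (simp only: R_gen_def R_mult_tensor if_True if_False * simp_thms) (auto simp: tensor_def fun_eq_iff)
  qed
  show "R_mult p q (R_gen p i) (R_gen p j) = R_mult p q (R_gen p j) (R_gen p i)"
    if "\<not> (i \<le> p \<longleftrightarrow> j \<le> p)"
    using assms that by (auto simp: R_gen_def R_mult_tensor u)
qed

definition R_representation ::
    "nat \<Rightarrow> nat \<Rightarrow> ((nat set \<times> nat set \<Rightarrow> real) \<Rightarrow> real^'n^'n) \<Rightarrow> bool" where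
  "R_representation p q \<rho> \<longleftrightarrow>
     (\<forall>x\<in>R_carrier p q. \<forall>y\<in>R_carrier p q. \<rho> (\<lambda>k. x k + y k) = \<rho> x + \<rho> y) \<and>
     (\<forall>c. \<forall>x\<in>R_carrier p q. \<rho> (\<lambda>k. c * x k) = c *\<^sub>R \<rho> x) \<and>
     (\<forall>x\<in>R_carrier p q. \<forall>y\<in>R_carrier p q. \<rho> (R_mult p q x y) = \<rho> x ** \<rho> y) \<and>
     \<rho> R_one = mat 1"


section \<open>Rational functions and rational maps\<close>

text \<open>
  Since \<open>\<complex>\<close> is infinite, polynomials on \<open>\<complex>\<^sup>m\<close> may be treated as functions. Rational functions
  are treated as functions which are only relevant up to equality on a nonempty Zariski open set.
\<close>

inductive polynomial_fun :: "(complex^'n \<Rightarrow> complex) \<Rightarrow> bool" where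
  const: "polynomial_fun (\<lambda>v. c)"
| coord: "polynomial_fun (\<lambda>v. v $ i)"
| add: "polynomial_fun f \<Longrightarrow> polynomial_fun g \<Longrightarrow> polynomial_fun (\<lambda>v. f v + g v)"
| mult: "polynomial_fun f \<Longrightarrow> polynomial_fun g \<Longrightarrow> polynomial_fun (\<lambda>v. f v * g v)"

definition homogeneous_polynomial :: "nat \<Rightarrow> (complex^'n \<Rightarrow> complex) \<Rightarrow> bool" where
  "homogeneous_polynomial d f \<longleftrightarrow>
     polynomial_fun f \<and> (\<forall>c v. f (c *s v) = c ^ d * f v)"

text \<open>Every nonempty Zariski open set contains a nonempty set of the form \<open>{v. h v \<noteq> 0}\<close>.\<close>

definition generically :: "(complex^'n \<Rightarrow> bool) \<Rightarrow> bool" where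
  "generically P \<longleftrightarrow>
     (\<exists>h. polynomial_fun h \<and> (\<exists>v. h v \<noteq> 0) \<and> (\<forall>v. h v \<noteq> 0 \<longrightarrow> P v))"

definition homogeneous_rational :: "(complex^'n \<Rightarrow> complex) \<Rightarrow> bool" where
  "homogeneous_rational f \<longleftrightarrow>
     (\<exists>a b k l. homogeneous_polynomial k a \<and> homogeneous_polynomial l b \<and>
        generically (\<lambda>v. b v \<noteq> 0 \<and> f v = a v / b v))"

definition proj_eq :: "complex^'n \<Rightarrow> complex^'n \<Rightarrow> bool" where
  "proj_eq x y \<longleftrightarrow> x \<noteq> 0 \<and> y \<noteq> 0 \<and> (\<exists>c. x = c *s y)"

definition homogeneous_map :: "nat \<Rightarrow> (complex^'n \<Rightarrow> complex^'n) \<Rightarrow> bool" where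
  "homogeneous_map d F \<longleftrightarrow> (\<forall>i. homogeneous_polynomial d (\<lambda>v. F v $ i))"

text \<open>
  A rational map between projective spaces is given by homogeneous polynomials of the same
  degree; it is birational if it has an inverse rational map.
\<close>

definition birational :: "(complex^'n \<Rightarrow> complex^'n) \<Rightarrow> bool" where
  "birational F \<longleftrightarrow>
     (\<exists>d. homogeneous_map d F) \<and>
     (\<exists>G e. homogeneous_map e G \<and>
        generically (\<lambda>v. F v \<noteq> 0 \<and> proj_eq (G (F v)) v) \<and>
        generically (\<lambda>x. G x \<noteq> 0 \<and> proj_eq (F (G x)) x))"


section \<open>Homaloidal functions\<close>

text \<open>The dual space of \<open>\<complex>\<^sup>m\<close> is identified with \<open>\<complex>\<^sup>m\<close> via the standard bilinear form.\<close>

definition grad :: "(complex^'n \<Rightarrow> complex) \<Rightarrow> complex^'n \<Rightarrow> complex^'n" where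
  "grad f v = (\<chi> i. deriv (\<lambda>t. f (v + axis i t)) 0)"

definition grad_log :: "(complex^'n \<Rightarrow> complex) \<Rightarrow> complex^'n \<Rightarrow> complex^'n" where
  "grad_log f v = inverse (f v) *s grad f v"

text \<open>\<open>F\<close> is a representative of \<open>v \<mapsto> [grad f v]\<close> obtained by clearing denominators.\<close>

definition homaloidal :: "(complex^'n \<Rightarrow> complex) \<Rightarrow> bool" where
  "homaloidal f \<longleftrightarrow>
     homogeneous_rational f \<and>
     (\<exists>F. birational F \<and> generically (\<lambda>v. proj_eq (grad f v) (F v)))"

text \<open>
  \<open>g\<close> is, as a rational function, the multiplicative Legendre transform of \<open>f\<close>. The composition
  is formed with the fraction \<open>a / b\<close> representing \<open>g\<close>, as \<open>g\<close> itself may take arbitrary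
  values on a proper Zariski closed set.
\<close>

definition mult_legendre ::
    "(complex^'n \<Rightarrow> complex) \<Rightarrow> (complex^'n \<Rightarrow> complex) \<Rightarrow> bool" where
  "mult_legendre f g \<longleftrightarrow>
     (\<exists>a b. polynomial_fun a \<and> polynomial_fun b \<and>
        generically (\<lambda>x. b x \<noteq> 0 \<and> g x = a x / b x) \<and>
        generically (\<lambda>v. f v \<noteq> 0 \<and> b (grad_log f v) \<noteq> 0 \<and>
          a (grad_log f v) / b (grad_log f v) = 1 / f v))"

definition homaloidal_EKP :: "(complex^'n \<Rightarrow> complex) \<Rightarrow> bool" where
  "homaloidal_EKP f \<longleftrightarrow>
     polynomial_fun f \<and> homaloidal f \<and> (\<exists>g. polynomial_fun g \<and> mult_legendre f g)"


section \<open>Clifford quartic forms\<close>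

definition quad_form :: "real^'n^'n \<Rightarrow> complex^'n \<Rightarrow> complex" where
  "quad_form S w = (\<Sum>i\<in>UNIV. \<Sum>j\<in>UNIV. w $ i * complex_of_real (S $ i $ j) * w $ j)"

definition clifford_quartic ::
    "nat \<Rightarrow> nat \<Rightarrow> (nat \<Rightarrow> real^'n^'n) \<Rightarrow> complex^'n \<Rightarrow> complex" where
  "clifford_quartic p q S w =
     (\<Sum>i=1..p. (quad_form (S i) w)\<^sup>2) - (\<Sum>i=p+1..p+q. (quad_form (S i) w)\<^sup>2)"

text \<open>
  The rank of the differential of \<open>Q = (S\<^sub>1[w], \<dots>, S\<^sub>p\<^sub>+\<^sub>q[w])\<close> is the row rank of the Jacobian
  matrix; its rows are the gradients of the components.
\<close>

definition nondegenerate :: "nat \<Rightarrow> nat \<Rightarrow> (nat \<Rightarrow> real^'n^'n) \<Rightarrow> bool" where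
  "nondegenerate p q S \<longleftrightarrow>
     (\<forall>w. clifford_quartic p q S w \<noteq> 0 \<longrightarrow>
        vec.dim ((\<lambda>i. grad (quad_form (S i)) w) ` {1..p+q}) = p + q) \<and>
     (\<exists>w. clifford_quartic p q S w \<noteq> 0)"

end

(*
  Put e_i = 1 for i <= p and e_i = -1 for i > p, write P for the Clifford quartic form, and let
  A = sum_i e_i S_i[w] S_i = X - Y, where X and Y collect the indices i <= p and i > p. Then
  grad P(w) = 4 F(w) with F(w) = A w. The Clifford relations give XY = YX and
  (X + Y)(X - Y) = P(w), and A S_i A = e_i (2 S_i[w] A - P(w) S_i), which evaluated at w yields
  S_i[F(w)] = e_i P(w) S_i[w]. Hence P(F(w)) = P(w)^3 and F(F(w)) = P(w)^2 w. So F is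
  projectively an involution, grad log P = 4 F / P is an involution, and
  P(grad log P(w)) = 256 / P(w).
*)
theory Submission
  imports Defs
begin

section \<open>Polynomial functions\<close>

lemma polynomial_fun_sum:
  assumes "\<And>i. i \<in> A \<Longrightarrow> polynomial_fun (f i)"
  shows "polynomial_fun (\<lambda>v. \<Sum>i\<in>A. f i v)"
  using assms
proof (induction A rule: infinite_finite_induct)
  case (insert i A)
  then show ?case by (simp add: polynomial_fun.add)
qed (simp_all add: polynomial_fun.const)

lemma polynomial_fun_power:
  "polynomial_fun f \<Longrightarrow> polynomial_fun (\<lambda>v. f v ^ n)"
  by (induction n) (simp_all add: polynomial_fun.const polynomial_fun.mult)

lemma polynomial_fun_diff:
  assumes "polynomial_fun f" "polynomial_fun g"
  shows "polynomial_fun (\<lambda>v. f v - g v)"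
proof -
  have "polynomial_fun (\<lambda>v. f v + (-1) * g v)"
    using assms by (intro polynomial_fun.intros)
  then show ?thesis by simp
qed

text \<open>Reduces several variables to one: on a line the question becomes one about univariate
  polynomials, which form a domain and, over an infinite field, are determined by their
  values.\<close>

lemma polynomial_fun_line:
  assumes "polynomial_fun f"
  shows "\<exists>r. \<forall>t. f (u + t *s v) = poly r t"
  using assms
proof induction
  case (const c)
  show ?case by (rule exI[of _ "[:c:]"]) simp
next
  case (coord i)
  show ?case by (rule exI[of _ "[:u $ i, v $ i:]"]) simp
next
  case (add f g)
  then obtain r s where "\<forall>t. f (u + t *s v) = poly r t" "\<forall>t. g (u + t *s v) = poly s t"
    by blast
  then show ?case by (intro exI[of _ "r + s"]) simp
next
  case (mult f g)
  then obtain r s where "\<forall>t. f (u + t *s v) = poly r t" "\<forall>t. g (u + t *s v) = poly s t"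
    by blast
  then show ?case by (intro exI[of _ "r * s"]) simp
qed

text \<open>The polynomial ring is a domain: restrict both factors to the line through two points where
  they do not vanish.\<close>

lemma polynomial_fun_mult_nonzero:
  assumes f: "polynomial_fun f" "f u \<noteq> 0" and g: "polynomial_fun g" "g v \<noteq> 0"
  shows "\<exists>w. f w * g w \<noteq> 0"
proof -
  obtain r where r: "\<And>t. f (u + t *s (v - u)) = poly r t"
    using polynomial_fun_line[OF f(1), of u "v - u"] by blast
  obtain s where s: "\<And>t. g (u + t *s (v - u)) = poly s t"
    using polynomial_fun_line[OF g(1), of u "v - u"] by blast
  have "r \<noteq> 0" using r[of 0] f(2) by auto
  moreover have "s \<noteq> 0" using s[of 1] g(2) by auto
  ultimately have "r * s \<noteq> 0" by simp
  then obtain t where "poly (r * s) t \<noteq> 0"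
    using poly_all_0_iff_0 by blast
  then show ?thesis using r s by (metis poly_mult)
qed

text \<open>Affine space is irreducible: the product of the two witnesses cuts out the intersection
  of both open sets, and it is not identically zero because polynomial functions form a
  domain.\<close>

lemma generically_conj:
  assumes "generically A" "generically B"
  shows "generically (\<lambda>v. A v \<and> B v)"
proof -
  obtain h k where h: "polynomial_fun h" "\<exists>v. h v \<noteq> 0" "\<And>v. h v \<noteq> 0 \<Longrightarrow> A v"
    and k: "polynomial_fun k" "\<exists>v. k v \<noteq> 0" "\<And>v. k v \<noteq> 0 \<Longrightarrow> B v"
    using assms unfolding generically_def by blast
  have "\<exists>w. h w * k w \<noteq> 0"
    using h k polynomial_fun_mult_nonzero by blast
  then show ?thesis
    unfolding generically_def using h k polynomial_fun.mult
    by (intro exI[of _ "\<lambda>v. h v * k v"]) auto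
qed

lemma generically_mono:
  "generically A \<Longrightarrow> (\<And>v. A v \<Longrightarrow> B v) \<Longrightarrow> generically B"
  unfolding generically_def by blast

lemma generically_nonzero:
  "polynomial_fun h \<Longrightarrow> h w \<noteq> 0 \<Longrightarrow> generically (\<lambda>v. h v \<noteq> 0)"
  unfolding generically_def by blast

text \<open>Substituting the rational map \<open>G / h\<close> into a polynomial leaves a power of
  \<open>h\<close> as the only denominator. This is used to pull open conditions back along the
  logarithmic gradient.\<close>

lemma polynomial_fun_clear_denominators:
  assumes k: "polynomial_fun k" and h: "polynomial_fun h"
    and G: "\<And>i. polynomial_fun (\<lambda>v. G v $ i)"
  shows "\<exists>N r. polynomial_fun r \<and> (\<forall>v. h v \<noteq> 0 \<longrightarrow> k (inverse (h v) *s G v) * h v ^ N = r v)"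
  using k
proof induction
  case (const c)
  show ?case
    by (rule exI[of _ 0], rule exI[of _ "\<lambda>v. c"]) (simp add: polynomial_fun.const)
next
  case (coord i)
  show ?case
    by (rule exI[of _ 1], rule exI[of _ "\<lambda>v. G v $ i"]) (simp add: G)
next
  case (add f g)
  then obtain M N r s where r: "polynomial_fun r" "polynomial_fun s"
    and f: "\<And>v. h v \<noteq> 0 \<Longrightarrow> f (inverse (h v) *s G v) * h v ^ M = r v"
    and g: "\<And>v. h v \<noteq> 0 \<Longrightarrow> g (inverse (h v) *s G v) * h v ^ N = s v"
    by blast
  \<comment> \<open>The exponent \<open>M + N\<close> serves as a common denominator without
    comparing \<open>M\<close> and \<open>N\<close>.\<close>
  have "(f (inverse (h v) *s G v) + g (inverse (h v) *s G v)) * h v ^ (M + N) =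
      r v * h v ^ N + s v * h v ^ M" if "h v \<noteq> 0" for v
    unfolding f[OF that, symmetric] g[OF that, symmetric] by (simp add: power_add algebra_simps)
  moreover have "polynomial_fun (\<lambda>v. r v * h v ^ N + s v * h v ^ M)"
    using r h by (intro polynomial_fun.intros polynomial_fun_power)
  ultimately show ?case by blast
next
  case (mult f g)
  then obtain M N r s where r: "polynomial_fun r" "polynomial_fun s"
    and f: "\<And>v. h v \<noteq> 0 \<Longrightarrow> f (inverse (h v) *s G v) * h v ^ M = r v"
    and g: "\<And>v. h v \<noteq> 0 \<Longrightarrow> g (inverse (h v) *s G v) * h v ^ N = s v"
    by blast
  have "(f (inverse (h v) *s G v) * g (inverse (h v) *s G v)) * h v ^ (M + N) = r v * s v"
    if "h v \<noteq> 0" for v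
    unfolding f[OF that, symmetric] g[OF that, symmetric] by (simp add: power_add algebra_simps)
  moreover have "polynomial_fun (\<lambda>v. r v * s v)"
    using r by (intro polynomial_fun.intros)
  ultimately show ?case by blast
qed

section \<open>Symmetric Clifford systems\<close>

definition bil :: "complex^'n \<Rightarrow> complex^'n \<Rightarrow> complex" where
  "bil u v = (\<Sum>k\<in>UNIV. u $ k * v $ k)"

lemma bil_simps:
  "bil (u + u') v = bil u v + bil u' v" "bil u (v + v') = bil u v + bil u v'"
  "bil (u - u') v = bil u v - bil u' v" "bil u (v - v') = bil u v - bil u v'"
  "bil (c *s u) v = c * bil u v" "bil u (c *s v) = c * bil u v"
  by (simp_all add: bil_def distrib_left distrib_right left_diff_distrib right_diff_distrib
      sum.distrib sum_subtractf sum_distrib_left mult_ac)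

lemma bil_commute: "bil u v = bil v u"
  by (simp add: bil_def mult.commute)

lemma bil_sum_left: "bil (sum f A) v = (\<Sum>i\<in>A. bil (f i) v)"
  by (induction A rule: infinite_finite_induct) (simp_all add: bil_simps, simp_all add: bil_def)

lemma bil_sum_right: "bil u (sum f A) = (\<Sum>i\<in>A. bil u (f i))"
  by (induction A rule: infinite_finite_induct) (simp_all add: bil_simps, simp_all add: bil_def)

lemma bil_axis: "bil (axis k t) v = t * v $ k" "bil v (axis k t) = t * v $ k"
  by (simp_all add: bil_def axis_def if_distrib if_distribR cong: if_cong)

lemma bil_matrix_vector_mult:
  "bil u (A *v v) = bil (transpose A *v u) v"
proof -
  have "bil u (A *v v) = (\<Sum>i\<in>UNIV. \<Sum>j\<in>UNIV. u $ i * (A $ i $ j * v $ j))"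
    by (simp add: bil_def matrix_vector_mult_def sum_distrib_left)
  also have "\<dots> = (\<Sum>j\<in>UNIV. \<Sum>i\<in>UNIV. u $ i * (A $ i $ j * v $ j))"
    by (rule sum.swap)
  also have "\<dots> = bil (transpose A *v u) v"
    by (simp add: bil_def matrix_vector_mult_def transpose_def sum_distrib_left mult_ac)
  finally show ?thesis .
qed

lemma matrix_vector_mult_sum: "A *v sum f K = (\<Sum>i\<in>K. A *v f i)" for A :: "complex^'n^'m"
  by (induction K rule: infinite_finite_induct)
     (simp_all add: matrix_vector_right_distrib)

lemma scale_sum: "c *s sum f K = (\<Sum>i\<in>K. c *s f i)" for c :: complex
  by (induction K rule: infinite_finite_induct) (simp_all add: vec.scale_right_distrib)

lemma sum_scale: "(\<Sum>i\<in>K. f i *s v) = sum f K *s v" for f :: "'a \<Rightarrow> complex"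
  by (induction K rule: infinite_finite_induct) (simp_all add: vec.scale_left_distrib)

text \<open>The two blocks of indices enter symmetrically, so exchanging them gives another
  instance. The relations are stated on vectors, the form in which the operators are composed
  below.\<close>

locale clifford_system =
  fixes I J :: "nat set" and T :: "nat \<Rightarrow> complex^'n^'n"
  assumes fin: "finite I" "finite J" and disj: "I \<inter> J = {}"
    and sym: "i \<in> I \<union> J \<Longrightarrow> transpose (T i) = T i"
    and square: "i \<in> I \<union> J \<Longrightarrow> T i *v (T i *v v) = v"
    and anti: "i \<in> I \<and> j \<in> I \<or> i \<in> J \<and> j \<in> J \<Longrightarrow> i \<noteq> j \<Longrightarrow> T i *v (T j *v v) = - (T j *v (T i *v v))"
    and comm: "i \<in> I \<Longrightarrow> j \<in> J \<Longrightarrow> T i *v (T j *v v) = T j *v (T i *v v)"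
begin

definition form :: "nat \<Rightarrow> complex^'n \<Rightarrow> complex" where
  "form i w = bil w (T i *v w)"

text \<open>The operator sum_i a_i T_i. Its coefficients are independent of the argument
  \<open>v\<close>, so it is linear even where they are later frozen at the values
  \<open>form i w\<close>.\<close>

definition comb :: "nat set \<Rightarrow> (nat \<Rightarrow> complex) \<Rightarrow> complex^'n \<Rightarrow> complex^'n" where
  "comb K a v = (\<Sum>i\<in>K. a i *s (T i *v v))"

definition quartic :: "complex^'n \<Rightarrow> complex" where
  "quartic w = (\<Sum>i\<in>I. (form i w)\<^sup>2) - (\<Sum>i\<in>J. (form i w)\<^sup>2)"

definition cubic :: "complex^'n \<Rightarrow> complex^'n" where
  "cubic w = comb I (\<lambda>i. form i w) w - comb J (\<lambda>i. form i w) w"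

section \<open>Algebra of the operators sum_i a_i T_i\<close>

lemma comb_simps:
  "comb K a (u + v) = comb K a u + comb K a v"
  "comb K a (u - v) = comb K a u - comb K a v"
  "comb K a (c *s v) = c *s comb K a v"
  "comb K (\<lambda>i. c * a i) v = c *s comb K a v"
  "comb K (\<lambda>i. - a i) v = - comb K a v"
  by (simp_all add: comb_def matrix_vector_right_distrib matrix_vector_mult_diff_distrib
      vec.scale_right_distrib vec.scale_right_diff_distrib sum.distrib sum_subtractf
      vector_scalar_commute scale_sum vec.scale_scale mult.commute sum_negf)

lemma comb_sum: "comb K a (sum f L) = (\<Sum>j\<in>L. comb K a (f j))"
  by (induction L rule: infinite_finite_induct)
     (simp_all add: comb_simps, simp_all add: comb_def)

lemma T_comb: "T i *v comb K a v = (\<Sum>j\<in>K. a j *s (T i *v (T j *v v)))"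
  unfolding comb_def matrix_vector_mult_sum by (simp add: vector_scalar_commute)

text \<open>Within one block T_i T_j + T_j T_i is 0 for j different from i and 2 for j = i, so a
  single summand survives.\<close>

lemma T_comb_anticommute:
  assumes K: "K = I \<or> K = J" and i: "i \<in> K"
  shows "T i *v comb K a v + comb K a (T i *v v) = (2 * a i) *s v"
proof -
  have fK: "finite K" using K fin by auto
  have "T i *v comb K a v + comb K a (T i *v v) =
     (\<Sum>j\<in>K. a j *s (T i *v (T j *v v) + T j *v (T i *v v)))"
    unfolding T_comb unfolding comb_def by (simp add: vec.scale_right_distrib sum.distrib)
  also have "\<dots> = (\<Sum>j\<in>K. if j = i then (2 * a i) *s v else 0)"
  proof (rule sum.cong[OF refl])
    fix j assume j: "j \<in> K"
    show "a j *s (T i *v (T j *v v) + T j *v (T i *v v)) = (if j = i then (2 * a i) *s v else 0)"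
    proof (cases "j = i")
      case True
      have "T i *v (T i *v v) = v" using square K i by auto
      then show ?thesis using True by (simp add: vec_eq_iff)
    next
      case False
      have "T i *v (T j *v v) = - (T j *v (T i *v v))" using anti[of i j] K i j False by auto
      then show ?thesis using False by simp
    qed
  qed
  also have "\<dots> = (2 * a i) *s v" using fK i by simp
  finally show ?thesis .
qed

lemma T_comb_commute:
  assumes "i \<in> I \<and> K = J \<or> i \<in> J \<and> K = I"
  shows "comb K a (T i *v v) = T i *v comb K a v"
  unfolding T_comb unfolding comb_def using assms comm by (intro sum.cong) auto

text \<open>The Clifford identity (sum_i a_i T_i)^2 = sum_i a_i^2. Expanding once the outer and once
  the inner factor and adding the results produces only anticommutators, at the price of a factor 2
  that is cancelled at the end.\<close>

lemma comb_comb: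
  assumes K: "K = I \<or> K = J"
  shows "comb K a (comb K a v) = (\<Sum>i\<in>K. (a i)\<^sup>2) *s v"
proof -
  have 1: "comb K a (comb K a v) = (\<Sum>i\<in>K. a i *s (T i *v comb K a v))"
    by (simp add: comb_def)
  have 2: "comb K a (comb K a v) = (\<Sum>i\<in>K. a i *s comb K a (T i *v v))"
    by (subst (2) comb_def) (simp add: comb_sum comb_simps)
  have "comb K a (comb K a v) + comb K a (comb K a v) =
      (\<Sum>i\<in>K. a i *s (T i *v comb K a v + comb K a (T i *v v)))"
    by (subst 1, subst 2) (simp add: vec.scale_right_distrib sum.distrib)
  also have "\<dots> = (\<Sum>i\<in>K. (2 * (a i)\<^sup>2) *s v)"
    using T_comb_anticommute[OF K] by (intro sum.cong) (simp_all add: power2_eq_square mult_ac)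
  also have "\<dots> = 2 *s ((\<Sum>i\<in>K. (a i)\<^sup>2) *s v)"
    by (simp add: sum_scale sum_distrib_left)
  finally show ?thesis
    by (simp add: vec_eq_iff flip: mult_2)
qed

lemma comb_comb_commute: "comb I a (comb J b v) = comb J b (comb I a v)"
proof -
  have "comb I a (comb J b v) = (\<Sum>j\<in>J. b j *s comb I a (T j *v v))"
    by (subst (2) comb_def) (simp add: comb_sum comb_simps)
  also have "\<dots> = (\<Sum>j\<in>J. b j *s (T j *v comb I a v))"
    using T_comb_commute by (intro sum.cong) auto
  finally show ?thesis by (simp add: comb_def)
qed

section \<open>The cubic map and the values of the forms on its image\<close>

lemma bil_comb:
  assumes "K \<subseteq> I \<union> J"
  shows "bil u (comb K a v) = bil (comb K a u) v"
  unfolding comb_def bil_sum_left bil_sum_right bil_simps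
  using assms sym by (intro sum.cong refl) (auto simp: bil_matrix_vector_mult simp del: transpose_matrix_vector)

lemma bil_T: "i \<in> I \<union> J \<Longrightarrow> bil u (T i *v v) = bil (T i *v u) v"
  by (simp add: bil_matrix_vector_mult sym del: transpose_matrix_vector)

text \<open>Euler's identity for a form of degree 4, since \<open>cubic\<close> is a quarter of the
  gradient of \<open>quartic\<close>.\<close>

lemma bil_cubic: "bil w (cubic w) = quartic w"
  by (simp add: cubic_def comb_def quartic_def bil_simps bil_sum_right power2_eq_square form_def)

text \<open>With A = X - Y, moving T_i past X costs an anticommutator and past Y nothing, so T_i A =
  2 a_i - (X + Y) T_i. As A (X + Y) = X^2 - Y^2 is the scalar \<open>quartic w\<close>, this
  determines A T_i A, and the symmetry of A turns it into the value at A w.\<close>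

lemma form_cubic_I:
  assumes i: "i \<in> I"
  shows "form i (cubic w) = quartic w * form i w"
proof -
  let ?a = "\<lambda>i. form i w"
  let ?X = "comb I ?a" and ?Y = "comb J ?a"
  have TX: "T i *v ?X v = (2 * ?a i) *s v - ?X (T i *v v)" for v
    using T_comb_anticommute[of I i ?a v] i by (simp add: algebra_simps)
  have TY: "T i *v ?Y v = ?Y (T i *v v)" for v
    using T_comb_commute[of i J] i by auto
  have XX: "?X (?X v) = (\<Sum>i\<in>I. (?a i)\<^sup>2) *s v" for v by (rule comb_comb) simp
  have YY: "?Y (?Y v) = (\<Sum>i\<in>J. (?a i)\<^sup>2) *s v" for v by (rule comb_comb) simp
  let ?A = "\<lambda>v. ?X v - ?Y v"
  have "?A (T i *v ?A w) = (2 * ?a i) *s ?A w - quartic w *s (T i *v w)"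
    by (simp add: matrix_vector_mult_diff_distrib TX TY comb_simps XX YY comb_comb_commute
        quartic_def vec.scale_left_diff_distrib vec.scale_right_diff_distrib)
  moreover have "bil (?A w) (T i *v ?A w) = bil w (?A (T i *v ?A w))"
    using bil_comb[of I] bil_comb[of J] by (simp add: bil_simps)
  ultimately have "form i (cubic w) = bil w ((2 * ?a i) *s cubic w - quartic w *s (T i *v w))"
    by (simp add: form_def cubic_def)
  \<comment> \<open>Here \<open>bil_cubic\<close> makes the difference 2 a_i P - P a_i, with P =
    \<open>quartic w\<close>.\<close>
  also have "\<dots> = quartic w * form i w"
    by (simp add: bil_simps bil_cubic) (simp add: form_def)
  finally show ?thesis .
qed

lemma form_scale: "form i (c *s v) = c\<^sup>2 * form i v"
  by (simp add: form_def bil_simps vector_scalar_commute power2_eq_square)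

text \<open>Exchanging the blocks negates both \<open>cubic\<close> and \<open>quartic\<close>. The
  quadratic form does not see the first sign; the second one remains.\<close>

lemma form_cubic_J:
  assumes i: "i \<in> J"
  shows "form i (cubic w) = - quartic w * form i w"
proof -
  interpret swap: clifford_system J I T
  proof
    show "finite J" "finite I" "J \<inter> I = {}"
      using fin disj by auto
  qed (rule sym square anti comm[symmetric]; blast)+
  have "swap.cubic w = (-1) *s cubic w" "swap.quartic w = - quartic w"
    by (simp_all add: swap.cubic_def cubic_def swap.quartic_def quartic_def)
  then show ?thesis
    using swap.form_cubic_I[OF i, of w] by (simp only: form_scale) simp
qed

text \<open>The signs by which the two blocks differ disappear on squaring, leaving a common factor
  \<open>(quartic w)\<^sup>2\<close>.\<close>

lemma quartic_cubic: "quartic (cubic w) = quartic w ^ 3"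
proof -
  have "quartic (cubic w) =
      (\<Sum>i\<in>I. (quartic w)\<^sup>2 * (form i w)\<^sup>2) - (\<Sum>i\<in>J. (quartic w)\<^sup>2 * (form i w)\<^sup>2)"
    unfolding quartic_def[of "cubic w"]
    by (simp add: form_cubic_I form_cubic_J power_mult_distrib cong: sum.cong)
  also have "\<dots> = (quartic w)\<^sup>2 * quartic w"
    by (simp add: quartic_def[of w] right_diff_distrib flip: sum_distrib_left)
  finally show ?thesis by (simp add: power3_eq_cube power2_eq_square)
qed

text \<open>The opposite signs of the form values on the two blocks replace X - Y by P (X + Y) in
  the outer application, where P = \<open>quartic w\<close>, and (X + Y)(X - Y) = X^2 - Y^2 =
  P.\<close>

lemma cubic_cubic: "cubic (cubic w) = (quartic w)\<^sup>2 *s w"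
proof -
  let ?a = "\<lambda>i. form i w"
  let ?X = "comb I ?a" and ?Y = "comb J ?a"
  have I: "comb I (\<lambda>i. form i (cubic w)) v = quartic w *s ?X v" for v
    unfolding comb_simps(4)[symmetric] unfolding comb_def by (simp add: form_cubic_I)
  have J: "comb J (\<lambda>i. form i (cubic w)) v = - (quartic w *s ?Y v)" for v
    unfolding comb_simps(4)[symmetric] comb_simps(5)[symmetric] unfolding comb_def
    by (simp add: form_cubic_J)
  have XX: "?X (?X v) = (\<Sum>i\<in>I. (?a i)\<^sup>2) *s v" for v by (rule comb_comb) simp
  have YY: "?Y (?Y v) = (\<Sum>i\<in>J. (?a i)\<^sup>2) *s v" for v by (rule comb_comb) simp
  have "cubic (cubic w) = quartic w *s (?X (?X w - ?Y w) + ?Y (?X w - ?Y w))"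
    unfolding cubic_def[of "cubic w"] I J
    by (simp add: vec.scale_right_distrib) (simp add: cubic_def)
  also have "?X (?X w - ?Y w) + ?Y (?X w - ?Y w) = quartic w *s w"
    by (simp add: comb_simps XX YY comb_comb_commute quartic_def vec.scale_left_diff_distrib)
  finally show ?thesis by (simp add: power2_eq_square)
qed

section \<open>Homogeneity, polynomiality and the logarithmic gradient\<close>

lemma form_add_scale:
  assumes "i \<in> I \<union> J"
  shows "form i (v + t *s u) = form i v + 2 * t * bil u (T i *v v) + t\<^sup>2 * form i u"
proof -
  \<comment> \<open>Symmetry of \<open>T i\<close> merges the two cross terms.\<close>
  have "bil v (T i *v u) = bil u (T i *v v)"
    using bil_T[OF assms] bil_commute by metis
  then show ?thesis
    unfolding form_def matrix_vector_right_distrib vector_scalar_commute bil_simps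
    by (simp add: power2_eq_square algebra_simps)
qed

lemma quartic_scale: "quartic (c *s v) = c ^ 4 * quartic v"
proof -
  have "(c\<^sup>2)\<^sup>2 = c ^ 4" by (simp flip: power_mult)
  then show ?thesis
    by (simp add: quartic_def form_scale power_mult_distrib right_diff_distrib sum_distrib_left)
qed

lemma cubic_scale: "cubic (c *s v) = c ^ 3 *s cubic v"
  by (simp add: cubic_def form_scale comb_simps vec.scale_right_diff_distrib
      power2_eq_square power3_eq_cube mult.assoc)

lemma polynomial_fun_T: "polynomial_fun (\<lambda>v. (T i *v v) $ k)"
  by (simp add: matrix_vector_mult_def)
     (intro polynomial_fun_sum polynomial_fun.intros)

lemma polynomial_fun_form: "polynomial_fun (form i)"
  unfolding form_def bil_def
  by (intro polynomial_fun_sum polynomial_fun.intros polynomial_fun_T)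

lemma polynomial_fun_quartic: "polynomial_fun quartic"
  unfolding quartic_def
  by (intro polynomial_fun_sum polynomial_fun_diff polynomial_fun_power polynomial_fun_form)

lemma polynomial_fun_cubic: "polynomial_fun (\<lambda>v. cubic v $ k)"
  unfolding cubic_def comb_def vector_minus_component sum_component vector_smult_component
  by (intro polynomial_fun_sum polynomial_fun_diff polynomial_fun.intros polynomial_fun_T
      polynomial_fun_form)

lemma grad_quartic: "grad quartic v = 4 *s cubic v"
proof -
  \<comment> \<open>The derivative is the linear coefficient in the expansion along a coordinate
    line.\<close>
  have D: "((\<lambda>t. form i (v + axis k t)) has_field_derivative 2 * (T i *v v) $ k) (at 0)"
    if i: "i \<in> I \<union> J" for i k
  proof -
    have "t *s axis k (1::complex) = axis k t" for t
      by (simp add: vec_eq_iff axis_def)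
    then have "form i (v + axis k t) =
        form i v + 2 * t * (T i *v v) $ k + t\<^sup>2 * form i (axis k 1)" for t
      using form_add_scale[OF i, of v t "axis k 1"] by (simp only: bil_axis mult_1)
    moreover have "((\<lambda>t. a + 2 * t * b + t\<^sup>2 * c) has_field_derivative 2 * b) (at 0)" for a b c :: complex
      by (auto intro!: derivative_eq_intros)
    ultimately show ?thesis by simp
  qed
  have "deriv (\<lambda>t. quartic (v + axis k t)) 0 = 4 * cubic v $ k" for k
  proof (rule DERIV_imp_deriv)
    \<comment> \<open>Each 4 is a 2 from the outer square times the 2 from \<open>D\<close>.\<close>
    have "((\<lambda>t. quartic (v + axis k t)) has_field_derivative
        (\<Sum>i\<in>I. 4 * form i v * (T i *v v) $ k) - (\<Sum>i\<in>J. 4 * form i v * (T i *v v) $ k)) (at 0)"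
      unfolding quartic_def
      by (intro DERIV_diff DERIV_sum; rule derivative_eq_intros, rule D) (auto simp: axis_eq_0_iff[THEN iffD2])
    also have "(\<Sum>i\<in>I. 4 * form i v * (T i *v v) $ k) - (\<Sum>i\<in>J. 4 * form i v * (T i *v v) $ k) =
        4 * cubic v $ k"
      by (simp add: cubic_def comb_def right_diff_distrib sum_distrib_left mult_ac)
    finally show "((\<lambda>t. quartic (v + axis k t)) has_field_derivative 4 * cubic v $ k) (at 0)" .
  qed
  then show ?thesis by (simp add: grad_def vec_eq_iff)
qed

lemma grad_log_quartic: "grad_log quartic v = inverse (quartic v) *s (4 *s cubic v)"
  by (simp add: grad_log_def grad_quartic)

text \<open>Degree 4 turns the scalar 4 / P into 256 / P^4, and \<open>quartic_cubic\<close>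
  supplies P^3, where P = \<open>quartic v\<close>.\<close>

lemma quartic_grad_log:
  assumes "quartic v \<noteq> 0"
  shows "quartic (grad_log quartic v) = 256 / quartic v"
  using assms
  by (simp add: grad_log_quartic quartic_scale quartic_cubic field_simps eval_nat_numeral)

lemma grad_log_grad_log:
  assumes "quartic v \<noteq> 0"
  shows "grad_log quartic (grad_log quartic v) = v"
proof -
  \<comment> \<open>The constant is (4 / P)^3 P^2 = 64 / P, with P =
    \<open>quartic v\<close>.\<close>
  have "cubic (grad_log quartic v) = (64 / quartic v) *s v"
    using assms
    by (simp add: grad_log_quartic cubic_scale cubic_cubic field_simps eval_nat_numeral)
  then have "grad_log quartic (grad_log quartic v) =
      (inverse (256 / quartic v) * (4 * (64 / quartic v))) *s v"
    by (simp add: grad_log_quartic[of "grad_log quartic v"] quartic_grad_log[OF assms])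
  also have "inverse (256 / quartic v) * (4 * (64 / quartic v)) = 1"
    using assms by simp
  finally show ?thesis by simp
qed

lemma homogeneous_map_cubic: "homogeneous_map 3 cubic"
  by (simp add: homogeneous_map_def homogeneous_polynomial_def polynomial_fun_cubic cubic_scale)

lemma quartic_nonzeroD:
  assumes "quartic v \<noteq> 0"
  shows "v \<noteq> 0" "cubic v \<noteq> 0"
proof -
  have 0: "quartic 0 = 0" using quartic_scale[of 0 0] by simp
  show "v \<noteq> 0" using 0 assms by auto
  show "cubic v \<noteq> 0" using 0 assms quartic_cubic[of v] by auto
qed

section \<open>Homaloidality and the Legendre transform of a quartic that is not identically
  zero\<close>

context
  fixes w assumes w: "quartic w \<noteq> 0"
begin

text \<open>By \<open>cubic_cubic\<close> the map is its own projective inverse wherever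
  \<open>quartic\<close> does not vanish, so both genericity conditions coincide.\<close>

lemma birational_cubic: "birational cubic"
proof -
  have "generically (\<lambda>v. quartic v \<noteq> 0)"
    using polynomial_fun_quartic w by (rule generically_nonzero)
  then have "generically (\<lambda>v. cubic v \<noteq> 0 \<and> proj_eq (cubic (cubic v)) v)"
    by (rule generically_mono) (auto simp: proj_eq_def cubic_cubic quartic_nonzeroD)
  then show ?thesis
    unfolding birational_def using homogeneous_map_cubic by blast
qed

lemma homaloidal_quartic: "homaloidal quartic"
proof -
  have gen: "generically (\<lambda>v. quartic v \<noteq> 0)"
    using polynomial_fun_quartic w by (rule generically_nonzero)
  have "homogeneous_rational quartic"
    unfolding homogeneous_rational_def
  proof (intro exI conjI)
    show "homogeneous_polynomial 4 quartic"
      by (simp add: homogeneous_polynomial_def polynomial_fun_quartic quartic_scale)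
    show "homogeneous_polynomial 0 (\<lambda>v::complex^'n. 1)"
      by (simp add: homogeneous_polynomial_def polynomial_fun.const)
    show "generically (\<lambda>v. (1::complex) \<noteq> 0 \<and> quartic v = quartic v / 1)"
      using gen by (rule generically_mono) simp
  qed
  moreover have "generically (\<lambda>v. proj_eq (grad quartic v) (cubic v))"
    using gen by (rule generically_mono) (auto simp: proj_eq_def grad_quartic quartic_nonzeroD)
  ultimately show ?thesis
    unfolding homaloidal_def using birational_cubic by blast
qed

lemma mult_legendre_quartic: "mult_legendre quartic (\<lambda>x. quartic x / 256)"
  unfolding mult_legendre_def
proof (intro exI conjI)
  have gen: "generically (\<lambda>v. quartic v \<noteq> 0)"
    using polynomial_fun_quartic w by (rule generically_nonzero)
  show "polynomial_fun quartic" by (rule polynomial_fun_quartic)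
  show "polynomial_fun (\<lambda>x::complex^'n. 256)" by (rule polynomial_fun.const)
  show "generically (\<lambda>x. (256::complex) \<noteq> 0 \<and> quartic x / 256 = quartic x / 256)"
    using gen by (rule generically_mono) simp
  show "generically (\<lambda>v. quartic v \<noteq> 0 \<and> (256::complex) \<noteq> 0 \<and>
      quartic (grad_log quartic v) / 256 = 1 / quartic v)"
    using gen by (rule generically_mono) (simp add: quartic_grad_log)
qed

text \<open>A nonempty open set has a nonempty open preimage under the logarithmic gradient, because
  that map is a rational involution.\<close>

lemma generically_grad_log:
  assumes "generically A"
  shows "generically (\<lambda>x. A (grad_log quartic x))"
proof -
  obtain h where h: "polynomial_fun h" "\<exists>v. h v \<noteq> 0" "\<And>v. h v \<noteq> 0 \<Longrightarrow> A v"
    using assms unfolding generically_def by blast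
  have "\<And>i. polynomial_fun (\<lambda>v. (4 *s cubic v) $ i)"
    unfolding vector_smult_component by (intro polynomial_fun.intros polynomial_fun_cubic)
  from polynomial_fun_clear_denominators[OF h(1) polynomial_fun_quartic this]
  obtain N r where r: "polynomial_fun r"
    and eq: "\<And>v. quartic v \<noteq> 0 \<Longrightarrow> h (grad_log quartic v) * quartic v ^ N = r v"
    unfolding grad_log_quartic by blast
  obtain v where "h v * quartic v \<noteq> 0"
    using h polynomial_fun_mult_nonzero[OF _ _ polynomial_fun_quartic w] by blast
  then have v: "h v \<noteq> 0" "quartic v \<noteq> 0" by auto
  \<comment> \<open>At the image of \<open>v\<close> the involution brings the argument of
    \<open>h\<close> back to \<open>v\<close>, so \<open>r\<close> takes there the value
    \<open>h v * (256 / quartic v) ^ N\<close>.\<close>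
  have "r (grad_log quartic v) \<noteq> 0"
    using v eq[of "grad_log quartic v"] by (auto simp: grad_log_grad_log quartic_grad_log)
  then have "generically (\<lambda>x. r x \<noteq> 0)"
    using r generically_nonzero by blast
  moreover have "generically (\<lambda>v. quartic v \<noteq> 0)"
    using polynomial_fun_quartic w by (rule generically_nonzero)
  ultimately have "generically (\<lambda>x. r x \<noteq> 0 \<and> quartic x \<noteq> 0)"
    by (rule generically_conj)
  then show ?thesis
    by (rule generically_mono) (use eq h(3) in force)
qed

text \<open>The defining equation prescribes the fraction a / b only on the image of the logarithmic
  gradient. Evaluating it at v = \<open>grad_log quartic x\<close> makes its argument x itself, with
  value 1 / \<open>quartic v\<close> = \<open>quartic x / 256\<close>.\<close>

lemma mult_legendre_quartic_unique:
  assumes "mult_legendre quartic g"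
  shows "generically (\<lambda>x. g x = quartic x / 256)"
proof -
  obtain a b where g: "generically (\<lambda>x. b x \<noteq> 0 \<and> g x = a x / b x)"
    and ab: "generically (\<lambda>v. quartic v \<noteq> 0 \<and> b (grad_log quartic v) \<noteq> 0 \<and>
          a (grad_log quartic v) / b (grad_log quartic v) = 1 / quartic v)"
    using assms unfolding mult_legendre_def by blast
  have "generically (\<lambda>v. quartic v \<noteq> 0)"
    using polynomial_fun_quartic w by (rule generically_nonzero)
  from generically_conj[OF this generically_conj[OF g generically_grad_log[OF ab]]]
  show ?thesis
    by (rule generically_mono) (auto simp: grad_log_grad_log quartic_grad_log)
qed

end

end

section \<open>Representations of the tensor product\<close>

lemma R_gen_carrier:
  assumes "i \<in> {1..p+q}"
  shows "R_gen p i \<in> R_carrier p q"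
  using assms
  by (auto simp: R_carrier_def R_gen_def tensor_def clifford_basis_def split: if_splits)

text \<open>Compatibility of a representation with scalars is assumed on the carrier only, so
  negating a product of generators requires its membership.\<close>

lemma R_mult_carrier:
  assumes x: "x \<in> R_carrier p q" and y: "y \<in> R_carrier p q"
  shows "R_mult p q x y \<in> R_carrier p q"
  unfolding R_carrier_def
proof (intro CollectI allI impI)
  fix C D assume "R_mult p q x y (C, D) \<noteq> 0"
  then have "(\<Sum>A\<in>Pow {1..p}. \<Sum>B\<in>Pow {p+1..p+q}. clifford_sign A (sym_diff A C) *
      clifford_sign B (sym_diff B D) * x (A, B) * y (sym_diff A C, sym_diff B D)) \<noteq> 0"
    by (simp add: R_mult_def)
  then obtain A where A: "A \<in> Pow {1..p}"
    and "(\<Sum>B\<in>Pow {p+1..p+q}. clifford_sign A (sym_diff A C) *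
      clifford_sign B (sym_diff B D) * x (A, B) * y (sym_diff A C, sym_diff B D)) \<noteq> 0"
    by (rule sum.not_neutral_contains_not_neutral)
  from this(2) obtain B where B: "B \<in> Pow {p+1..p+q}"
    and "clifford_sign A (sym_diff A C) *
      clifford_sign B (sym_diff B D) * x (A, B) * y (sym_diff A C, sym_diff B D) \<noteq> 0"
    by (rule sum.not_neutral_contains_not_neutral)
  then have "y (sym_diff A C, sym_diff B D) \<noteq> 0"
    by simp
  then have "sym_diff A C \<subseteq> {1..p}" "sym_diff B D \<subseteq> {p+1..p+q}"
    using y unfolding R_carrier_def by blast+
  \<comment> \<open>C is the symmetric difference of A and \<open>sym_diff A C\<close>, and likewise
    for D.\<close>
  then show "C \<subseteq> {1..p} \<and> D \<subseteq> {p+1..p+q}"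
    using A B by blast
qed

section \<open>From real matrices to operators on complex vectors\<close>

definition complexify :: "real^'n^'m \<Rightarrow> complex^'n^'m" where
  "complexify A = (\<chi> i j. complex_of_real (A $ i $ j))"

lemma complexify_mult: "complexify (A ** B) = complexify A ** complexify B"
  by (simp add: complexify_def matrix_matrix_mult_def vec_eq_iff)

lemma complexify_mat_1: "complexify (mat 1) = mat 1"
  by (simp add: complexify_def mat_def vec_eq_iff)

lemma complexify_minus: "complexify (- A) = - complexify A"
  by (simp add: complexify_def vec_eq_iff)

lemma transpose_complexify: "transpose (complexify A) = complexify (transpose A)"
  by (simp add: complexify_def transpose_def vec_eq_iff)

lemma quad_form_complexify: "quad_form A w = bil w (complexify A *v w)"
  by (simp add: quad_form_def bil_def complexify_def matrix_vector_mult_def sum_distrib_left mult_ac)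

text \<open>The relations between the generators pass through the homomorphism and through
  complexification. Generators of different tensor factors commute because the tensor product is
  ungraded.\<close>

lemma clifford_system_representation:
  fixes \<rho> :: "(nat set \<times> nat set \<Rightarrow> real) \<Rightarrow> real^'n^'n"
  assumes \<rho>: "R_representation p q \<rho>"
    and S: "\<And>i. i \<in> {1..p+q} \<Longrightarrow> S i = \<rho> (R_gen p i)"
    and sym: "\<And>i. i \<in> {1..p+q} \<Longrightarrow> transpose (S i) = S i"
  shows "clifford_system {1..p} {p+1..p+q} (\<lambda>i. complexify (S i))"
proof -
  have \<rho>_mult: "\<rho> (R_mult p q x y) = \<rho> x ** \<rho> y"
    if "x \<in> R_carrier p q" "y \<in> R_carrier p q" for x y
    using \<rho> that unfolding R_representation_def by (elim conjE) (blast dest: bspec)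
  have \<rho>_one: "\<rho> R_one = mat 1"
    using \<rho> unfolding R_representation_def by (elim conjE)
  have mult: "S i ** S j = \<rho> (R_mult p q (R_gen p i) (R_gen p j))"
    if "i \<in> {1..p+q}" "j \<in> {1..p+q}" for i j
    unfolding S[OF that(1)] S[OF that(2)] using that by (simp only: \<rho>_mult R_gen_carrier)
  have neg: "\<rho> (\<lambda>k. - x k) = - \<rho> x" if "x \<in> R_carrier p q" for x
  proof -
    have "\<rho> (\<lambda>k. (-1) * x k) = (-1) *\<^sub>R \<rho> x"
      using \<rho> that unfolding R_representation_def by (elim conjE) blast
    then show ?thesis by simp
  qed
  have square: "S i ** S i = mat 1" if "i \<in> {1..p+q}" for i
    using that by (simp only: mult R_gen_relations(1) \<rho>_one)
  have anti: "S i ** S j = - (S j ** S i)"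
    if "i \<in> {1..p+q}" "j \<in> {1..p+q}" "i \<noteq> j" "i \<le> p \<longleftrightarrow> j \<le> p" for i j
    unfolding mult[OF that(1,2)] mult[OF that(2,1)] R_gen_relations(2)[OF that]
    by (intro neg R_mult_carrier R_gen_carrier that)
  have comm: "S i ** S j = S j ** S i"
    if "i \<in> {1..p+q}" "j \<in> {1..p+q}" "\<not> (i \<le> p \<longleftrightarrow> j \<le> p)" for i j
    unfolding mult[OF that(1,2)] mult[OF that(2,1)] R_gen_relations(3)[OF that] ..
  have minus: "(- A) *v v = - (A *v v)" for A :: "complex^'n^'n" and v
    by (simp add: matrix_vector_mult_def vec_eq_iff sum_negf)
  show ?thesis
  proof
    show "finite {1..p}" "finite {p+1..p+q}" "{1..p} \<inter> {p+1..p+q} = {}"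
      by auto
    fix i j v
    show "transpose (complexify (S i)) = complexify (S i)" if "i \<in> {1..p} \<union> {p+1..p+q}"
      using that sym[of i] by (auto simp: transpose_complexify)
    show "complexify (S i) *v (complexify (S i) *v v) = v" if "i \<in> {1..p} \<union> {p+1..p+q}"
      using that square[of i]
      by (auto simp: matrix_vector_mul_assoc complexify_mat_1 simp flip: complexify_mult)
    show "complexify (S i) *v (complexify (S j) *v v) = - (complexify (S j) *v (complexify (S i) *v v))"
      if "i \<in> {1..p} \<and> j \<in> {1..p} \<or> i \<in> {p+1..p+q} \<and> j \<in> {p+1..p+q}" "i \<noteq> j"
    proof -
      have "S i ** S j = - (S j ** S i)"
        by (rule anti) (use that in auto)
      then show ?thesis
        by (simp add: matrix_vector_mul_assoc complexify_minus minus flip: complexify_mult)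
    qed
    show "complexify (S i) *v (complexify (S j) *v v) = complexify (S j) *v (complexify (S i) *v v)"
      if "i \<in> {1..p}" "j \<in> {p+1..p+q}"
    proof -
      have "S i ** S j = S j ** S i"
        by (rule comm) (use that in auto)
      then show ?thesis
        by (simp add: matrix_vector_mul_assoc flip: complexify_mult)
    qed
  qed
qed

theorem theorem4p4:
  fixes p q :: nat
    and \<rho> :: "(nat set \<times> nat set \<Rightarrow> real) \<Rightarrow> real^'n^'n"
    and S :: "nat \<Rightarrow> real^'n^'n"
  assumes "p + q \<ge> 1"
    and "R_representation p q \<rho>"
    and "\<And>i. i \<in> {1..p+q} \<Longrightarrow> S i = \<rho> (R_gen p i)"
    and "\<And>i. i \<in> {1..p+q} \<Longrightarrow> transpose (S i) = S i"
    and "nondegenerate p q S"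
  shows "homaloidal_EKP (clifford_quartic p q S) \<and>
    (\<forall>g. mult_legendre (clifford_quartic p q S) g \<longrightarrow>
       (\<exists>c. c \<noteq> 0 \<and> generically (\<lambda>x. g x = c * clifford_quartic p q S x)))"
proof -
  interpret clifford_system "{1..p}" "{p+1..p+q}" "\<lambda>i. complexify (S i)"
    by (rule clifford_system_representation[where \<rho> = \<rho>]) (fact assms)+
  have P: "clifford_quartic p q S = quartic"
    by (rule ext) (simp only: clifford_quartic_def quartic_def form_def quad_form_complexify)
  \<comment> \<open>Nondegeneracy provides a point outside the zero set, as required by the generic
    statements.\<close>
  obtain w where w: "quartic w \<noteq> 0"
    using assms(5) unfolding nondegenerate_def P by blast
  have "polynomial_fun (\<lambda>x. (1 / 256) * quartic x)"
    by (intro polynomial_fun.intros polynomial_fun_quartic)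
  then have "homaloidal_EKP quartic"
    unfolding homaloidal_EKP_def
    using polynomial_fun_quartic homaloidal_quartic[OF w] mult_legendre_quartic[OF w] by auto
  moreover have "\<exists>c. c \<noteq> 0 \<and> generically (\<lambda>x. g x = c * quartic x)"
    if "mult_legendre quartic g" for g
    \<comment> \<open>The factor 1/256 is forced by P(grad log P) = 256 / P.\<close>
    using mult_legendre_quartic_unique[OF w that] by (intro exI[of _ "1 / 256"]) simp
  ultimately show ?thesis unfolding P by blast
qed

end
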